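(* Let $\lambda\in\Omega'(\mathcal{M},d)$ and $c_1,c_2\in\mathbb{C}$. Then the initial value problem consisting of the system $(E_\lambda)$ together with the initial conditions $$y_1(a)=c_1,\qquad y^{[1]}(a-1)=c_2$$ has a unique solution $y=y(t,\lambda)$ on $\mathcal{I}'$.
   Context: Let $a\in\mathbb{Z}$, $\mathcal{I}=\{a,a+1,a+2,\dots\}$, $\mathcal{I}'=\{a-1,a,a+1,\dots\}$. $\nabla y(t)=y(t)-y(t-1)$, $\Delta y(t)=y(t+1)-y(t)$. Let $p,q,c,h,d:\mathcal{I}'\to\mathbb{R}$ with $p(t)\ne0$ for all $t\in\mathcal{I}'$. For $\lambda\in\mathbb{C}$, $(E_\lambda)$ (abbreviated $\mathcal{L}(y)=\lambda y$ on $\mathcal{I}'$) is the system for $y=(y_1,y_2)^{\mathrm T}:\mathcal{I}'\to\mathbb{C}^2$: $$-\nabla(p(t)\Delta y_1(t))+q(t)y_1(t)-\nabla(c(t)y_2(t))+h(t)y_2(t)=\lambda y_1(t),\quad t\in\mathcal{I},$$ $$c(t)\Delta y_1(t)+h(t)y_1(t)+d(t)y_2(t)=\lambda y_2(t),\quad t\in\mathcal{I}'.$$ The quasi-difference is $y^{[1]}(t)=p(t)\Delta y_1(t)+c(t)y_2(t)$, $t\in\mathcal{I}'$. For a real function $f$ on $\mathcal{I}'$, $\sigma(f)=\{\lambda\in\mathbb{R}:\inf_{t\in\mathcal{I}'}|\lambda-f(t)|=0\}$. Put $\mathcal{M}(t)=d(t)-\dfrac{c^2(t)-h(t)c(t)}{p(t)}$,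 $t\in\mathcal{I}'$, and $\Omega'(\mathcal{M},d)=\mathbb{C}\setminus(\sigma(\mathcal{M})\cup\sigma(d))$. *)

theory Defs
  imports "HOL-Analysis.Analysis"
begin

text \<open>
  With \<open>a\<close> an integer, the index sets are \<open>\<I> = {a..}\<close> and \<open>\<I>' = {a - 1..}\<close>.
  Coefficients on \<open>\<I>'\<close> are functions on all integers whose values below \<open>a - 1\<close> are never
  used: the backward difference is taken at \<open>t \<ge> a\<close> only.
\<close>

definition nabla :: "(int \<Rightarrow> 'a::minus) \<Rightarrow> int \<Rightarrow> 'a" where
  "nabla f t = f t - f (t - 1)"

definition fdelta :: "(int \<Rightarrow> 'a::minus) \<Rightarrow> int \<Rightarrow> 'a" where
  "fdelta f t = f (t + 1) - f t"

definition solves_system ::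
  "int \<Rightarrow> (int \<Rightarrow> real) \<Rightarrow> (int \<Rightarrow> real) \<Rightarrow> (int \<Rightarrow> real) \<Rightarrow> (int \<Rightarrow> real) \<Rightarrow> (int \<Rightarrow> real)
    \<Rightarrow> complex \<Rightarrow> (int \<Rightarrow> complex ^ 2) \<Rightarrow> bool" where
  "solves_system a p q c h d lam y \<longleftrightarrow>
     (\<forall>t\<in>{a..}.
        - nabla (\<lambda>s. of_real (p s) * fdelta (\<lambda>r. y r $ 1) s) t + of_real (q t) * y t $ 1
        - nabla (\<lambda>s. of_real (c s) * y s $ 2) t + of_real (h t) * y t $ 2 = lam * y t $ 1) \<and>
     (\<forall>t\<in>{a - 1..}.
        of_real (c t) * fdelta (\<lambda>r. y r $ 1) t + of_real (h t) * y t $ 1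
        + of_real (d t) * y t $ 2 = lam * y t $ 2)"

definition quasi_diff ::
  "(int \<Rightarrow> real) \<Rightarrow> (int \<Rightarrow> real) \<Rightarrow> (int \<Rightarrow> complex ^ 2) \<Rightarrow> int \<Rightarrow> complex" where
  "quasi_diff p c y t = of_real (p t) * fdelta (\<lambda>r. y r $ 1) t + of_real (c t) * y t $ 2"

definition sigma_set :: "int \<Rightarrow> (int \<Rightarrow> real) \<Rightarrow> real set" where
  "sigma_set a f = {l. (INF t\<in>{a - 1..}. \<bar>l - f t\<bar>) = 0}"

definition M_fun ::
  "(int \<Rightarrow> real) \<Rightarrow> (int \<Rightarrow> real) \<Rightarrow> (int \<Rightarrow> real) \<Rightarrow> (int \<Rightarrow> real) \<Rightarrow> int \<Rightarrow> real" where
  "M_fun p c h d t = d t - ((c t)\<^sup>2 - h t * c t) / p t"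

definition Omega' :: "int \<Rightarrow> (int \<Rightarrow> real) \<Rightarrow> (int \<Rightarrow> real) \<Rightarrow> complex set" where
  "Omega' a f g = UNIV - complex_of_real ` (sigma_set a f \<union> sigma_set a g)"

end

theory Submission
  imports Defs
begin

text \<open>
  The system is first order in the pair \<open>(y\<^sub>1(t), y\<^sup>[\<^sup>1\<^sup>](t - 1))\<close>, with \<open>y\<^sub>2(t)\<close> an auxiliary
  unknown tied to it algebraically. Written with \<open>x = y\<^sub>1(t)\<close>, \<open>x' = y\<^sub>1(t + 1)\<close>,
  \<open>u = y\<^sup>[\<^sup>1\<^sup>](t - 1)\<close>, \<open>u' = y\<^sup>[\<^sup>1\<^sup>](t)\<close> and \<open>z = y\<^sub>2(t)\<close>, the equations at time \<open>t\<close> are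
  \<open>c (x' - x) + h x + (d - \<lambda>) z = 0\<close>, \<open>u' = p (x' - x) + c z\<close> and
  \<open>u' - u = (q - \<lambda>) x + h z\<close>. For given \<open>(x, u)\<close> they are a linear system for \<open>x' - x\<close>
  and \<open>z\<close> with determinant \<open>c (c - h) - p (d - \<lambda>) = p (\<lambda> - \<M>(t))\<close>. At the left end
  point \<open>t = a - 1\<close> the third equation is absent and the pair \<open>(x', u')\<close> is prescribed
  instead; the resulting linear system for \<open>x' - x\<close> and \<open>z\<close> has the same determinant.

  Since \<open>\<lambda>\<close> avoids \<open>\<sigma>(\<M>)\<close>, which contains every value of \<open>\<M>\<close>, and \<open>p\<close> does not
  vanish, the determinant is never zero. Hence the initial data determine \<open>y(a - 1)\<close>
  uniquely, and each step upwards from \<open>t = a\<close> can be made in exactly one way.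
\<close>

lemma cramer_2x2:
  fixes A B C E e f x z :: "'a::field"
  assumes "A * E - B * C \<noteq> 0"
  shows "A * x + B * z = e \<and> C * x + E * z = f \<longleftrightarrow>
    x = (e * E - B * f) / (A * E - B * C) \<and> z = (A * f - e * C) / (A * E - B * C)"
    (is "?sys \<longleftrightarrow> ?sol")
proof
  assume ?sys
  then have "x * (A * E - B * C) = e * E - B * f" "z * (A * E - B * C) = A * f - e * C"
    by (auto simp: algebra_simps)
  with assms show ?sol
    by (simp add: eq_divide_eq)
next
  assume ?sol
  then have x: "x * (A * E - B * C) = e * E - B * f"
    and z: "z * (A * E - B * C) = A * f - e * C"
    using assms by simp_all
  have "(A * x + B * z) * (A * E - B * C)
      = A * (x * (A * E - B * C)) + B * (z * (A * E - B * C))"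
    by (simp add: algebra_simps)
  also have "\<dots> = e * (A * E - B * C)"
    unfolding x z by (simp add: algebra_simps)
  finally have "A * x + B * z = e"
    using assms by simp
  moreover have "(C * x + E * z) * (A * E - B * C)
      = C * (x * (A * E - B * C)) + E * (z * (A * E - B * C))"
    by (simp add: algebra_simps)
  then have "(C * x + E * z) * (A * E - B * C) = f * (A * E - B * C)"
    unfolding x z by (simp add: algebra_simps)
  then have "C * x + E * z = f"
    using assms by simp
  ultimately show ?sys ..
qed

text \<open>
  One step upwards in time: eliminating \<open>u'\<close> leaves a linear system for \<open>x' - x\<close> and \<open>z\<close>
  whose determinant is the quantity assumed to be nonzero.
\<close>

lemma forward_step_ex1:
  fixes p q c h d l x u :: "'a::field"
  assumes "c * (c - h) - (d - l) * p \<noteq> 0"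
  shows "\<exists>!(x', u', z). c * (x' - x) + h * x + d * z = l * z \<and>
    u' = p * (x' - x) + c * z \<and> u' - u = (q - l) * x + h * z"
proof -
  note solve = cramer_2x2[OF assms, of _ _ "- h * x" "u + (q - l) * x"]
  have "c * (x' - x) + h * x + d * z = l * z \<longleftrightarrow> c * (x' - x) + (d - l) * z = - h * x" for x' z
    by (rule diff_eq_diff_eq) (simp add: algebra_simps)
  moreover have "p * (x' - x) + c * z - u = (q - l) * x + h * z \<longleftrightarrow>
      p * (x' - x) + (c - h) * z = u + (q - l) * x" for x' z
    by (rule diff_eq_diff_eq) (simp add: algebra_simps)
  ultimately have "c * (x' - x) + h * x + d * z = l * z \<and>
      u' = p * (x' - x) + c * z \<and> u' - u = (q - l) * x + h * z \<longleftrightarrow>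
    u' = p * (x' - x) + c * z \<and>
      c * (x' - x) + (d - l) * z = - h * x \<and> p * (x' - x) + (c - h) * z = u + (q - l) * x"
    for x' u' z
    by blast
  then show ?thesis
    unfolding solve diff_eq_eq by auto
qed

text \<open>
  At the left end point the roles are exchanged: \<open>x'\<close> and \<open>u'\<close> are given. Since \<open>h\<close> now
  multiplies an unknown, it moves to the other diagonal entry, and the determinant is
  the same as in a forward step.
\<close>

lemma left_end_ex1:
  fixes p c h d l x' u' :: "'a::field"
  assumes "c * (c - h) - (d - l) * p \<noteq> 0"
  shows "\<exists>!(x, z). c * (x' - x) + h * x + d * z = l * z \<and> u' = p * (x' - x) + c * z"
proof -
  have det: "(c - h) * c - (d - l) * p \<noteq> 0"
    using assms by (simp add: mult.commute)
  note solve = cramer_2x2[OF det, of _ _ "- h * x'" u']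
  have "c * (x' - x) + h * x + d * z = l * z \<longleftrightarrow> (c - h) * (x' - x) + (d - l) * z = - h * x'" for x z
    by (rule diff_eq_diff_eq) (simp add: algebra_simps)
  then have "c * (x' - x) + h * x + d * z = l * z \<and> u' = p * (x' - x) + c * z \<longleftrightarrow>
    (c - h) * (x' - x) + (d - l) * z = - h * x' \<and> p * (x' - x) + c * z = u'" for x z
    by (auto simp only:)
  moreover have "x' - x = w \<longleftrightarrow> x = x' - w" for x w
    by (auto simp: algebra_simps)
  ultimately show ?thesis
    unfolding solve by auto
qed

text \<open>
  The second-order equation becomes a first-order recursion for the quasi-difference, since
  the two backward differences in it add up to \<open>- \<nabla>y\<^sup>[\<^sup>1\<^sup>]\<close>.
\<close>

lemma solves_system_iff_quasi_diff:
  "solves_system a p q c h d lam y \<longleftrightarrow>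
    (\<forall>t\<ge>a. quasi_diff p c y t - quasi_diff p c y (t - 1)
        = (of_real (q t) - lam) * y t $ 1 + of_real (h t) * y t $ 2) \<and>
    (\<forall>t\<ge>a - 1. of_real (c t) * (y (t + 1) $ 1 - y t $ 1) + of_real (h t) * y t $ 1
        + of_real (d t) * y t $ 2 = lam * y t $ 2)"
proof -
  have "- nabla (\<lambda>s. of_real (p s) * fdelta (\<lambda>r. y r $ 1) s) t + of_real (q t) * y t $ 1
        - nabla (\<lambda>s. of_real (c s) * y s $ 2) t + of_real (h t) * y t $ 2 = lam * y t $ 1 \<longleftrightarrow>
      (of_real (q t) - lam) * y t $ 1 + of_real (h t) * y t $ 2
        = quasi_diff p c y t - quasi_diff p c y (t - 1)" for t
    by (rule diff_eq_diff_eq) (simp add: quasi_diff_def nabla_def algebra_simps)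
  then show ?thesis
    unfolding solves_system_def fdelta_def by (auto simp only: atLeast_iff Ball_def)
qed

text \<open>
  The infimum defining \<open>\<sigma>(f)\<close> is attained, with value zero, at every index where \<open>f\<close>
  takes the value in question.
\<close>

lemma value_in_sigma_set:
  assumes "t \<ge> a - 1"
  shows "f t \<in> sigma_set a f"
proof -
  have bdd: "bdd_below ((\<lambda>s. \<bar>f t - f s\<bar>) ` {a - 1..})"
    by (auto intro!: bdd_belowI[of _ 0])
  have "(INF s\<in>{a - 1..}. \<bar>f t - f s\<bar>) \<le> \<bar>f t - f t\<bar>"
    using assms by (intro cINF_lower[OF bdd]) auto
  moreover have "(INF s\<in>{a - 1..}. \<bar>f t - f s\<bar>) \<ge> 0"
    by (rule cINF_greatest) auto
  ultimately show ?thesis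
    by (simp add: sigma_set_def)
qed

lemma step_determinant_nonzero:
  fixes p c h d :: "int \<Rightarrow> real" and lam :: complex
  assumes "p t \<noteq> 0" and "lam \<in> Omega' a (M_fun p c h d) d" and "t \<ge> a - 1"
  shows "of_real (c t) * (of_real (c t) - of_real (h t)) - (of_real (d t) - lam) * of_real (p t)
    \<noteq> (0 :: complex)" (is "?det \<noteq> 0")
proof -
  have "lam \<noteq> of_real (M_fun p c h d t)"
    using assms(2) value_in_sigma_set[OF assms(3), of "M_fun p c h d"]
    by (auto simp: Omega'_def)
  moreover have "?det = of_real (p t) * (lam - of_real (M_fun p c h d t))"
    using assms(1) by (simp add: M_fun_def field_simps power2_eq_square)
  ultimately show ?thesis
    using assms(1) by simp
qed

text \<open>
  Solutions agree by induction on the pair \<open>(y\<^sub>1(t), y\<^sup>[\<^sup>1\<^sup>](t - 1))\<close>; the second component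
  \<open>y\<^sub>2(t)\<close> is recovered from the step that leaves \<open>t\<close>.
\<close>

lemma initial_value_problem_unique:
  fixes y v :: "int \<Rightarrow> complex ^ 2"
  assumes det: "\<And>t. t \<ge> a - 1 \<Longrightarrow>
      of_real (c t) * (of_real (c t) - of_real (h t)) - (of_real (d t) - lam) * of_real (p t)
        \<noteq> (0 :: complex)"
    and y: "solves_system a p q c h d lam y" and v: "solves_system a p q c h d lam v"
    and init: "y a $ 1 = v a $ 1" "quasi_diff p c y (a - 1) = quasi_diff p c v (a - 1)"
    and "t \<ge> a - 1"
  shows "y t = v t"
proof -
  note y' = y[unfolded solves_system_iff_quasi_diff]
  note v' = v[unfolded solves_system_iff_quasi_diff]
  have qd: "quasi_diff p c w t = of_real (p t) * (w (t + 1) $ 1 - w t $ 1) + of_real (c t) * w t $ 2"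
    for w t
    by (simp add: quasi_diff_def fdelta_def)
  have forward: "y (s + 1) $ 1 = v (s + 1) $ 1 \<and> quasi_diff p c y s = quasi_diff p c v s
      \<and> y s $ 2 = v s $ 2"
    if "s \<ge> a" and eq: "y s $ 1 = v s $ 1" "quasi_diff p c y (s - 1) = quasi_diff p c v (s - 1)" for s
  proof -
    \<comment> \<open>The step from the pair that \<open>y\<close> and \<open>v\<close> share at \<open>s\<close>: both solutions realise it.\<close>
    define P where "P = (\<lambda>(x', u', z). of_real (c s) * (x' - v s $ 1) + of_real (h s) * v s $ 1
        + of_real (d s) * z = lam * z \<and>
        u' = of_real (p s) * (x' - v s $ 1) + of_real (c s) * z \<and>
        u' - quasi_diff p c v (s - 1) = (of_real (q s) - lam) * v s $ 1 + of_real (h s) * z)"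
    have "\<exists>!w. P w"
      unfolding P_def by (rule forward_step_ex1) (use det[of s] \<open>s \<ge> a\<close> in simp)
    moreover have "P (v (s + 1) $ 1, quasi_diff p c v s, v s $ 2)"
      using v' \<open>s \<ge> a\<close> by (simp add: P_def flip: qd)
    moreover have "P (y (s + 1) $ 1, quasi_diff p c y s, y s $ 2)"
      using y' \<open>s \<ge> a\<close> by (simp add: P_def flip: eq qd)
    ultimately have "(y (s + 1) $ 1, quasi_diff p c y s, y s $ 2)
        = (v (s + 1) $ 1, quasi_diff p c v s, v s $ 2)"
      by blast
    then show ?thesis
      by simp
  qed
  have agree: "y s $ 1 = v s $ 1 \<and> quasi_diff p c y (s - 1) = quasi_diff p c v (s - 1)"
    if "s \<ge> a" for s
    using that
  proof (induction s rule: int_ge_induct)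
    case base
    show ?case
      using init by simp
  next
    case (step i)
    then show ?case
      using forward[of i] by simp
  qed
  show ?thesis
  proof (cases "t \<ge> a")
    case True
    then show ?thesis
      using agree[of t] forward[of t] by (simp add: vec_eq_iff forall_2)
  next
    case False
    then have t: "t = a - 1"
      using \<open>t \<ge> a - 1\<close> by simp
    define P where "P = (\<lambda>(x, z). of_real (c t) * (v a $ 1 - x) + of_real (h t) * x
        + of_real (d t) * z = lam * z \<and>
        quasi_diff p c v t = of_real (p t) * (v a $ 1 - x) + of_real (c t) * z)"
    have "\<exists>!w. P w"
      unfolding P_def by (rule left_end_ex1) (rule det[OF \<open>t \<ge> a - 1\<close>])
    moreover have "P (v t $ 1, v t $ 2)"
      using v'[THEN conjunct2, rule_format, of t] qd[of v t] by (simp add: P_def t)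
    moreover have "P (y t $ 1, y t $ 2)"
      using y'[THEN conjunct2, rule_format, of t] qd[of y t] init by (simp add: P_def t)
    ultimately have "(y t $ 1, y t $ 2) = (v t $ 1, v t $ 2)"
      by blast
    then show ?thesis
      by (simp add: vec_eq_iff forall_2)
  qed
qed

text \<open>
  The forward steps give a sequence \<open>s n\<close> of pairs \<open>(y\<^sub>1(a + n), y\<^sup>[\<^sup>1\<^sup>](a + n - 1))\<close>. Its second
  components are prescribed numbers until \<open>y\<close> is shown to have them as quasi-differences;
  for \<open>n = 0\<close> this is the choice of \<open>y(a - 1)\<close>, for \<open>n > 0\<close> a part of the preceding step.
\<close>

lemma initial_value_problem_exists:
  fixes c1 c2 :: complex
  assumes det: "\<And>t. t \<ge> a - 1 \<Longrightarrow>
      of_real (c t) * (of_real (c t) - of_real (h t)) - (of_real (d t) - lam) * of_real (p t)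
        \<noteq> (0 :: complex)"
  obtains y :: "int \<Rightarrow> complex ^ 2"
  where "solves_system a p q c h d lam y" "y a $ 1 = c1" "quasi_diff p c y (a - 1) = c2"
proof -
  \<comment> \<open>The relation between \<open>(x, u)\<close> at \<open>t\<close> and \<open>(x', u')\<close> at \<open>t + 1\<close>, with \<open>z = y\<^sub>2(t)\<close>.\<close>
  define Step where "Step t x u x' u' z \<longleftrightarrow>
      of_real (c t) * (x' - x) + of_real (h t) * x + of_real (d t) * z = lam * z \<and>
      u' = of_real (p t) * (x' - x) + of_real (c t) * z \<and>
      u' - u = (of_real (q t) - lam) * x + of_real (h t) * z" for t x u x' u' z
  have "\<exists>s'. \<exists>z. Step (a + int n) (fst s) (snd s) (fst s') (snd s') z" for n s
  proof -
    have "\<exists>!(x', u', z). Step (a + int n) (fst s) (snd s) x' u' z"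
      unfolding Step_def by (rule forward_step_ex1) (rule det, simp)
    then obtain x' u' z where "Step (a + int n) (fst s) (snd s) x' u' z"
      by (auto dest: ex1_implies_ex)
    then show ?thesis
      by (intro exI[of _ "(x', u')"] exI[of _ z]) simp
  qed
  then have "\<exists>s. \<forall>n. (n = 0 \<longrightarrow> s n = (c1, c2)) \<and>
      (\<exists>z. Step (a + int n) (fst (s n)) (snd (s n)) (fst (s (Suc n))) (snd (s (Suc n))) z)"
    by (intro dependent_nat_choice) simp_all
  then obtain s where s0: "s 0 = (c1, c2)"
    and ex_z: "\<forall>n. \<exists>z. Step (a + int n) (fst (s n)) (snd (s n)) (fst (s (Suc n))) (snd (s (Suc n))) z"
    by blast
  obtain z
    where step: "\<And>n. Step (a + int n) (fst (s n)) (snd (s n)) (fst (s (Suc n))) (snd (s (Suc n))) (z n)"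
    using choice[OF ex_z] by auto
  obtain x0 z0
    where left: "of_real (c (a - 1)) * (c1 - x0) + of_real (h (a - 1)) * x0 + of_real (d (a - 1)) * z0
        = lam * z0"
      "c2 = of_real (p (a - 1)) * (c1 - x0) + of_real (c (a - 1)) * z0"
    using left_end_ex1[OF det[of "a - 1"], of c1 c2] by auto
  define y :: "int \<Rightarrow> complex ^ 2" where
    "y t = (if t \<ge> a then vector [fst (s (nat (t - a))), z (nat (t - a))] else vector [x0, z0])" for t
  have y_ge: "y (a + int n) = vector [fst (s n), z n]" for n
    by (simp add: y_def)
  have y_left: "y (a - 1) = vector [x0, z0]"
    by (simp add: y_def)
  have ya: "y a = vector [c1, z 0]"
    using y_ge[of 0] s0 by simp
  have y_Suc: "y (a + int n + 1) = vector [fst (s (Suc n)), z (Suc n)]" for n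
    using y_ge[of "Suc n"] by (simp add: algebra_simps)
  have qd_left: "quasi_diff p c y (a - 1) = c2"
    using left(2) by (simp add: quasi_diff_def fdelta_def y_left ya)
  have qd_ge: "quasi_diff p c y (a + int n) = snd (s (Suc n))" for n
    using step[of n] by (simp add: quasi_diff_def fdelta_def y_ge y_Suc Step_def)
  have qd_before: "quasi_diff p c y (a + int n - 1) = snd (s n)" for n
  proof (cases n)
    case 0
    then show ?thesis
      using qd_left s0 by simp
  next
    case (Suc m)
    then show ?thesis
      using qd_ge[of m] by simp
  qed
  have "solves_system a p q c h d lam y"
    unfolding solves_system_iff_quasi_diff
  proof (intro conjI allI impI)
    fix t assume "t \<ge> a"
    then obtain n where t: "t = a + int n"
      using zle_iff_zadd by blast
    show "quasi_diff p c y t - quasi_diff p c y (t - 1)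
        = (of_real (q t) - lam) * y t $ 1 + of_real (h t) * y t $ 2"
      using step[of n] unfolding t qd_ge qd_before y_ge Step_def vector_2 by blast
  next
    fix t assume "t \<ge> a - 1"
    then have "t = a - 1 \<or> t \<ge> a"
      by linarith
    then consider "t = a - 1" | n where "t = a + int n"
      by (blast dest: zle_iff_zadd[THEN iffD1])
    then show "of_real (c t) * (y (t + 1) $ 1 - y t $ 1) + of_real (h t) * y t $ 1
        + of_real (d t) * y t $ 2 = lam * y t $ 2"
    proof cases
      case 1
      then show ?thesis
        using left(1) by (simp add: y_left ya)
    next
      case 2
      then show ?thesis
        using step[of n] by (simp add: y_ge y_Suc Step_def)
    qed
  qed
  then show thesis
    using that qd_left ya by simp
qed

text \<open>
  The initial value problem looks at no value left of \<open>a - 1\<close>; so a solution may be changed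
  there, which makes it possible to pass to the extensional representative.
\<close>

lemma initial_value_problem_cong:
  assumes "\<And>t. t \<ge> a - 1 \<Longrightarrow> y t = v t"
  shows "solves_system a p q c h d lam y \<longleftrightarrow> solves_system a p q c h d lam v"
    and "quasi_diff p c y (a - 1) = quasi_diff p c v (a - 1)"
proof -
  have qd: "quasi_diff p c y t = quasi_diff p c v t" if "t \<ge> a - 1" for t
    using that assms by (simp add: quasi_diff_def fdelta_def)
  show "quasi_diff p c y (a - 1) = quasi_diff p c v (a - 1)"
    by (simp add: qd)
  show "solves_system a p q c h d lam y \<longleftrightarrow> solves_system a p q c h d lam v"
    unfolding solves_system_iff_quasi_diff using qd assms by simp
qed

theorem theorem2p1:
  fixes a :: int
    and p q c h d :: "int \<Rightarrow> real"
    and lam c1 c2 :: complex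
  assumes "\<forall>t\<in>{a - 1..}. p t \<noteq> 0"
    and "lam \<in> Omega' a (M_fun p c h d) d"
  shows "\<exists>!y. y \<in> {a - 1..} \<rightarrow>\<^sub>E (UNIV :: (complex ^ 2) set) \<and>
    solves_system a p q c h d lam y \<and> y a $ 1 = c1 \<and> quasi_diff p c y (a - 1) = c2"
proof -
  have det: "of_real (c t) * (of_real (c t) - of_real (h t)) - (of_real (d t) - lam) * of_real (p t)
      \<noteq> (0 :: complex)" if "t \<ge> a - 1" for t
    using step_determinant_nonzero[OF _ assms(2) that] assms(1) that by simp
  obtain y where y: "solves_system a p q c h d lam y" "y a $ 1 = c1" "quasi_diff p c y (a - 1) = c2"
    using initial_value_problem_exists[where a = a and p = p and c = c and h = h and d = d, OF det]
    by blast
  show ?thesis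
  proof (rule ex1I[of _ "restrict y {a - 1..}"])
    have on: "restrict y {a - 1..} t = y t" if "t \<ge> a - 1" for t
      using that by simp
    show "restrict y {a - 1..} \<in> {a - 1..} \<rightarrow>\<^sub>E UNIV \<and>
        solves_system a p q c h d lam (restrict y {a - 1..}) \<and> restrict y {a - 1..} a $ 1 = c1 \<and>
        quasi_diff p c (restrict y {a - 1..}) (a - 1) = c2"
      using y initial_value_problem_cong[of a "restrict y {a - 1..}" y, OF on] by auto
  next
    fix v :: "int \<Rightarrow> complex ^ 2"
    assume v: "v \<in> {a - 1..} \<rightarrow>\<^sub>E UNIV \<and> solves_system a p q c h d lam v \<and> v a $ 1 = c1 \<and>
        quasi_diff p c v (a - 1) = c2"
    have "v t = y t" if "t \<ge> a - 1" for t
      using initial_value_problem_unique[where a = a and p = p and c = c and h = h and d = d, OF det, of q v y t]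
        v y that by simp
    with v show "v = restrict y {a - 1..}"
      by (auto simp: PiE_def extensional_def fun_eq_iff)
  qed
qed

end
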